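(* Let $S$ be the substitution monad on $[\mathcal H^{\mathrm{op}},\mathbf{Set}]$, i.e. the monad induced by the free-forgetful adjunction $\{s\}\text{-}\mathbf{GAT}\leftrightarrows[\mathcal H^{\mathrm{op}},\mathbf{Set}]$, with $SX$ described by inc-lists as in the context. For each $X\in[\mathcal H^{\mathrm{op}},\mathbf{Set}]$, the unit map $\eta^S_X\colon X\to SX$ has components $$X(n)\to SX(n),\ A\mapsto(\iota_n,\tilde A)\qquad\text{and}\qquad\mathrm{Tm}_X(A)\to\mathrm{Tm}_{SX}(\iota_n,\tilde A),\ a\mapsto a.$$
   Context: \textbf{Expressions and judgements.} Fix a denumerable set $\mathrm{Var}$ of variables. Given an alphabet $\Xi$, the expressions over $\Xi$ are generated as follows: each $x\in\mathrm{Var}$ is an expression; if $n\geq 0$, $e_1,\dots,e_n$ are expressions and $w\in\Xi$, then $w(e_1,\dots,e_n)$ is an expression (written $w$ when $n=0$). $e'[e/x]$ denotes substitution of $e$ for $x$ in $e'$. A context is a (possibly empty) list $x_1:T_1,\dots,x_n:T_n$ of distinct variables $x_i$ and expressions $T_i$. A judgement is a string $\Gamma\vdash T\ \mathsf{type}$ (type judgement), $\Gamma\vdash t:T$ (term judgement), $\Gamma\vdash T=T'\ \mathsf{type}$ (type equality) or $\Gamma\vdash t=t':T$ (term equality), with $\Gamma$ a context and $t,t',T,T'$ expressions; its degree is one more than the length of $\Gamma$. The boundary of a judgement is a list of judgements: $\partial(\vdash T\ \mathsf{type})=()$; $\partial(\Gamma,x:T\vdash T'\ \mathsf{type})=(\Gamma\vdash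 T\ \mathsf{type})$; $\partial(\Gamma\vdash t:T)=(\Gamma\vdash T\ \mathsf{type})$; $\partial(\Gamma\vdash T=T'\ \mathsf{type})=(\Gamma\vdash T\ \mathsf{type},\ \Gamma\vdash T'\ \mathsf{type})$; $\partial(\Gamma\vdash t=t':T)=(\Gamma\vdash t:T,\ \Gamma\vdash t':T)$. \textbf{Deduction rules} (premises $\Longrightarrow$ conclusion; $\mathcal J$ stands for the right-hand side of any of the four judgement forms). \emph{Equality and $\alpha$ rules}: $\Gamma\vdash t:T\Longrightarrow\Gamma\vdash t=t:T$; $\Gamma\vdash t_1=t_2:T\Longrightarrow\Gamma\vdash t_2=t_1:T$; $\Gamma\vdash t_1=t_2:T$ and $\Gamma\vdash t_2=t_3:T\Longrightarrow\Gamma\vdash t_1=t_3:T$; $\Gamma\vdash T\ \mathsf{type}\Longrightarrow\Gamma\vdash T=T\ \mathsf{type}$; $\Gamma\vdash T_1=T_2\ \mathsf{type}\Longrightarrow\Gamma\vdash T_2=T_1\ \mathsf{type}$; $\Gamma\vdash T_1=T_2\ \mathsf{type}$ and $\Gamma\vdash T_2=T_3\ \mathsf{type}\Longrightarrow\Gamma\vdash T_1=T_3\ \mathsf{type}$; $\Gamma\vdash T_1=T_2\ \mathsf{type}$ and $\Gamma\vdash t:T_1\Longrightarrow\Gamma\vdash t:T_2$; $\Gamma\vdash T_1=T_2\ \mathsf{type}$ and $\Gamma\vdash t_1=t_2:T_1\Longrightarrow\Gamma\vdash t_1=t_2:T_2$; $\Gamma\vdash\mathcal J\Longrightarrow\sigma\cdot\Gamma\vdash\sigma\cdot\mathcal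 J$ for any permutation $\sigma\in\mathrm{Sym}(\mathrm{Var})$ acting on variables. \emph{Substitution} ($s$): $\Gamma\vdash t:T$ and $\Gamma,y:T,\Delta\vdash\mathcal J\Longrightarrow\Gamma,\Delta[t/y]\vdash\mathcal J[t/y]$; $\Gamma\vdash t_1=t_2:T$ and $\Gamma,y:T,\Delta\vdash T'\ \mathsf{type}\Longrightarrow\Gamma,\Delta[t_2/y]\vdash T'[t_1/y]=T'[t_2/y]\ \mathsf{type}$; $\Gamma\vdash t_1=t_2:T$ and $\Gamma,y:T,\Delta\vdash t':T'\Longrightarrow\Gamma,\Delta[t_2/y]\vdash t'[t_1/y]=t'[t_2/y]:T'[t_2/y]$. \textbf{$\{s\}$-GATs.} An $\{s\}$-GAT $\mathbb T$ consists of a collection $\Omega$ of type-constants, a collection $\Sigma$ of term-constants and a collection $\Lambda$ of basic judgements over $\Omega\amalg\Sigma$ such that: for each $A\in\Omega$ there is a unique judgement in $\Lambda$ of the form $x_1:T_1,\dots,x_{n-1}:T_{n-1}\vdash A(x_1,\dots,x_{n-1})\ \mathsf{type}$; for each $f\in\Sigma$ there is a unique judgement in $\Lambda$ of the form $x_1:T_1,\dots,x_{n-1}:T_{n-1}\vdash f(x_1,\dots,x_{n-1}):T$; all other elements of $\Lambda$ are type or term equality judgements; each element of $\Lambda$ lies in $\mathbb T^*$. Here $\mathbb T^*$, the collection of derived judgements, is the smallest collection closed under all the rules listed above and containing $\mathcal J\in\Lambda$ whenever it contains each judgement in $\partial(\mathcal J)$. An interpretation $\phi\colon\mathbb T\to\mathbb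 U$ is a function $\phi\colon\mathbb T^*\to\mathbb U^*$ preserving boundaries and preserving deduction: viewing each rule with $n$ premises (for each choice of parameters such as $\sigma$) as an $n$-ary partial function $r$ on judgements, $\phi(r(\mathcal J_1,\dots,\mathcal J_n))=r(\phi(\mathcal J_1),\dots,\phi(\mathcal J_n))$ whenever both sides are defined. On derived type judgements, $(x_1:S_1,\dots,x_{n-1}:S_{n-1}\vdash S_n\ \mathsf{type})\equiv(y_1:T_1,\dots,y_{m-1}:T_{m-1}\vdash T_m\ \mathsf{type})$ iff $n=m$ and for $1\le i\le n$ the judgement $x_1:S_1,\dots,x_{i-1}:S_{i-1}\vdash S_i=T_i[x_1/y_1,\dots,x_{i-1}/y_{i-1}]\ \mathsf{type}$ is derived. On derived term judgements, $(x_1:S_1,\dots,x_{n-1}:S_{n-1}\vdash s:S_n)\equiv(y_1:T_1,\dots,y_{m-1}:T_{m-1}\vdash t:T_m)$ iff their boundaries are $\equiv$ and $x_1:S_1,\dots,x_{n-1}:S_{n-1}\vdash s=t[x_1/y_1,\dots,x_{n-1}/y_{n-1}]:S_n$ is derived. $\{s\}\text{-}\mathbf{GAT}$ has $\{s\}$-GATs as objects and, as morphisms, interpretations modulo: $\phi\sim\phi'$ iff $\phi(\mathcal J)\equiv\phi'(\mathcal J)$ for each derived type or term judgement $\mathcal J$. \textbf{Type-and-term structures and the monad.} $[a,b]=\{a,\dots,b\}\subset\mathbb N$ and $[n]=[1,n]$. $\mathcal H$ is the category freely generated by the graph with objects $n$ and $n_t$ ($n\ge1$) and arrows $n\to n+1$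 and $n\to n_t$. For $X\in[\mathcal H^{\mathrm{op}},\mathbf{Set}]$ the maps $X(n+1)\to X(n)$, $X(n_t)\to X(n)$ are written $\partial$; elements of $X(n)$ are type-elements, elements of $X(n_t)$ term-elements; for $A\in X(n)$, $\mathrm{Tm}_X(A)=\{a\in X(n_t):\partial a=A\}$. The forgetful functor $V\colon\{s\}\text{-}\mathbf{GAT}\to[\mathcal H^{\mathrm{op}},\mathbf{Set}]$ has $V\mathbb T(n)$ (resp. $V\mathbb T(n_t)$) the set of derived type (resp. term) judgements of degree $n$ modulo $\equiv$, boundaries induced by $\partial$, and $V\phi([\mathcal J])=[\phi(\mathcal J)]$. Its left adjoint $G$ sends $X$ to the free $\{s\}$-GAT $GX$ whose type- and term-constants are the type- and term-elements of $X$ and whose basic judgements are $\mathcal J_A=(x_1:A_1,x_2:A_2(x_1),\dots,x_{n-1}:A_{n-1}(x_1,\dots,x_{n-2})\vdash A(x_1,\dots,x_{n-1})\ \mathsf{type})$ for $A\in X(n)$, where $A_i=\partial^{n-i}A$, and, in the same context, $\mathcal J_a=(\dots\vdash a(x_1,\dots,x_{n-1}):A(x_1,\dots,x_{n-1}))$ for $a\in\mathrm{Tm}_X(A)$. The adjunction unit is $A\mapsto[\mathcal J_A]$, $a\mapsto[\mathcal J_a]$. The monad is $S=VG$. \textbf{Inc-lists and description of $SX$.} An inc-list of length $n$ is a strictly increasing function $\alpha\colon[0,n]\to\mathbb N$ with $\alpha(0)=0$; $\mathrm{Inc}(n)$ is the set of these. For $\alpha\in\mathrm{Inc}(n+1)$,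 $\partial\alpha\in\mathrm{Inc}(n)$ is its restriction to $[0,n]$. The presheaf $[\alpha]$ has $[\alpha](i)=\{i\}$ if $i\le\alpha(n)$ and $\emptyset$ otherwise, $[\alpha](i_t)=\{i_t\}$ if $i\le\alpha(n)$ and $i\notin\mathrm{Im}\,\alpha$ and $\emptyset$ otherwise, with the unique possible boundary maps. For $h\colon[\alpha]\to X$, $\partial h$ is its restriction to $[\partial\alpha]$. One has $SX(n)=\sum_{\alpha\in\mathrm{Inc}(n)}[\mathcal H^{\mathrm{op}},\mathbf{Set}]([\alpha],X)$, $\partial(\alpha,h)=(\partial\alpha,\partial h)$, $\mathrm{Tm}_{SX}(\alpha,h)=\mathrm{Tm}_X(h(\alpha(n)))$, under the following identification. Define $e_j$ recursively for $1\le j\le\alpha(n)$ by $e_j=x_m$ if $j=\alpha(m)$ and $e_j=h(j_t)(e_1,\dots,e_{j-1})$ if $j\notin\mathrm{Im}\,\alpha$; then $(\alpha,h)$ is the class of $x_1:T_1,\dots,x_{n-1}:T_{n-1}\vdash T_n\ \mathsf{type}$ with $T_i=h(\alpha(i))(e_1,\dots,e_{\alpha(i)-1})$, and $a\in\mathrm{Tm}_X(h(\alpha(n)))$ is the class of $x_1:T_1,\dots,x_{n-1}:T_{n-1}\vdash a(e_1,\dots,e_{\alpha(n)-1}):T_n$. \textbf{Notation.} $\iota_n\in\mathrm{Inc}(n)$ is $\iota_n(i)=i$; for $A\in X(n)$, $\tilde A\colon[\iota_n]\to X$ is $\tilde A(i)=\partial^{n-i}(A)$ for $i\in[n]$. 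*)

theory Defs
  imports "HOL-Library.FuncSet"
begin

section \<open>Expressions, judgements and deduction\<close>

text \<open>The denumerable set of variables is the set of natural numbers. A context is a list with the
  outermost variable first; distinctness of its variables is demanded of the basic judgements of a
  theory, and every deduction rule preserves it.\<close>

type_synonym var = nat

datatype (syms: 'c) exp = Var var | Op 'c "'c exp list"

primrec subst :: "(var \<Rightarrow> 'c exp) \<Rightarrow> 'c exp \<Rightarrow> 'c exp" where
  "subst s (Var x) = s x"
| "subst s (Op w es) = Op w (map (subst s) es)"

definition single :: "var \<Rightarrow> 'c exp \<Rightarrow> var \<Rightarrow> 'c exp" where
  "single y t = Var(y := t)"

text \<open>The simultaneous substitution of the variables \<open>xs\<close> for the variables \<open>ys\<close>.\<close>

definition renaming :: "var list \<Rightarrow> var list \<Rightarrow> var \<Rightarrow> 'c exp" where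
  "renaming xs ys y = (case map_of (zip ys xs) y of Some x \<Rightarrow> Var x | None \<Rightarrow> Var y)"

type_synonym 'c ctx = "(var \<times> 'c exp) list"

text \<open>Right-hand sides of judgements; \<open>TermEq t t' T\<close> stands for \<open>t = t' : T\<close>.\<close>

datatype 'e rhs = IsType 'e | OfType 'e 'e | TypeEq 'e 'e | TermEq 'e 'e 'e

type_synonym 'c judgement = "'c ctx \<times> 'c exp rhs"

definition degree :: "'c judgement \<Rightarrow> nat" where
  "degree J = Suc (length (fst J))"

definition jsyms :: "'c judgement \<Rightarrow> 'c set" where
  "jsyms J = (\<Union>(x, T)\<in>set (fst J). syms T) \<union> (\<Union>e\<in>set_rhs (snd J). syms e)"

definition subst_ctx :: "(var \<Rightarrow> 'c exp) \<Rightarrow> 'c ctx \<Rightarrow> 'c ctx" where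
  "subst_ctx s = map (\<lambda>(x, T). (x, subst s T))"

definition perm_ctx :: "(var \<Rightarrow> var) \<Rightarrow> 'c ctx \<Rightarrow> 'c ctx" where
  "perm_ctx \<sigma> = map (\<lambda>(x, T). (\<sigma> x, subst (\<lambda>z. Var (\<sigma> z)) T))"

fun boundary :: "'c judgement \<Rightarrow> 'c judgement list" where
  "boundary (\<Gamma>, IsType T) = (if \<Gamma> = [] then [] else [(butlast \<Gamma>, IsType (snd (last \<Gamma>)))])"
| "boundary (\<Gamma>, OfType t T) = [(\<Gamma>, IsType T)]"
| "boundary (\<Gamma>, TypeEq T T') = [(\<Gamma>, IsType T), (\<Gamma>, IsType T')]"
| "boundary (\<Gamma>, TermEq t t' T) = [(\<Gamma>, OfType t T), (\<Gamma>, OfType t' T)]"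

inductive_set derived :: "'c judgement set \<Rightarrow> 'c judgement set" for \<Lambda> where
  basic: "J \<in> \<Lambda> \<Longrightarrow> (\<And>J'. J' \<in> set (boundary J) \<Longrightarrow> J' \<in> derived \<Lambda>) \<Longrightarrow> J \<in> derived \<Lambda>"
| tm_refl: "(\<Gamma>, OfType t T) \<in> derived \<Lambda> \<Longrightarrow> (\<Gamma>, TermEq t t T) \<in> derived \<Lambda>"
| tm_sym: "(\<Gamma>, TermEq t1 t2 T) \<in> derived \<Lambda> \<Longrightarrow> (\<Gamma>, TermEq t2 t1 T) \<in> derived \<Lambda>"
| tm_trans: "(\<Gamma>, TermEq t1 t2 T) \<in> derived \<Lambda> \<Longrightarrow> (\<Gamma>, TermEq t2 t3 T) \<in> derived \<Lambda>
    \<Longrightarrow> (\<Gamma>, TermEq t1 t3 T) \<in> derived \<Lambda>"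
| ty_refl: "(\<Gamma>, IsType T) \<in> derived \<Lambda> \<Longrightarrow> (\<Gamma>, TypeEq T T) \<in> derived \<Lambda>"
| ty_sym: "(\<Gamma>, TypeEq T1 T2) \<in> derived \<Lambda> \<Longrightarrow> (\<Gamma>, TypeEq T2 T1) \<in> derived \<Lambda>"
| ty_trans: "(\<Gamma>, TypeEq T1 T2) \<in> derived \<Lambda> \<Longrightarrow> (\<Gamma>, TypeEq T2 T3) \<in> derived \<Lambda>
    \<Longrightarrow> (\<Gamma>, TypeEq T1 T3) \<in> derived \<Lambda>"
| tm_conv: "(\<Gamma>, TypeEq T1 T2) \<in> derived \<Lambda> \<Longrightarrow> (\<Gamma>, OfType t T1) \<in> derived \<Lambda>
    \<Longrightarrow> (\<Gamma>, OfType t T2) \<in> derived \<Lambda>"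
| tm_eq_conv: "(\<Gamma>, TypeEq T1 T2) \<in> derived \<Lambda> \<Longrightarrow> (\<Gamma>, TermEq t1 t2 T1) \<in> derived \<Lambda>
    \<Longrightarrow> (\<Gamma>, TermEq t1 t2 T2) \<in> derived \<Lambda>"
| alpha: "(\<Gamma>, R) \<in> derived \<Lambda> \<Longrightarrow> bij \<sigma>
    \<Longrightarrow> (perm_ctx \<sigma> \<Gamma>, map_rhs (subst (\<lambda>z. Var (\<sigma> z))) R) \<in> derived \<Lambda>"
| substitution: "(\<Gamma>, OfType t T) \<in> derived \<Lambda> \<Longrightarrow> (\<Gamma> @ (y, T) # \<Delta>, R) \<in> derived \<Lambda>
    \<Longrightarrow> (\<Gamma> @ subst_ctx (single y t) \<Delta>, map_rhs (subst (single y t)) R) \<in> derived \<Lambda>"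
| ty_cong: "(\<Gamma>, TermEq t1 t2 T) \<in> derived \<Lambda> \<Longrightarrow> (\<Gamma> @ (y, T) # \<Delta>, IsType T') \<in> derived \<Lambda>
    \<Longrightarrow> (\<Gamma> @ subst_ctx (single y t2) \<Delta>,
         TypeEq (subst (single y t1) T') (subst (single y t2) T')) \<in> derived \<Lambda>"
| tm_cong: "(\<Gamma>, TermEq t1 t2 T) \<in> derived \<Lambda> \<Longrightarrow> (\<Gamma> @ (y, T) # \<Delta>, OfType t' T') \<in> derived \<Lambda>
    \<Longrightarrow> (\<Gamma> @ subst_ctx (single y t2) \<Delta>,
         TermEq (subst (single y t1) t') (subst (single y t2) t') (subst (single y t2) T'))
        \<in> derived \<Lambda>"


section \<open>Generalized algebraic theories with substitution\<close>

record ('o, 's) gat_sig =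
  TyConst :: "'o set"
  TmConst :: "'s set"
  Basic :: "('o + 's) judgement set"

definition intro_ty :: "'o \<Rightarrow> ('o + 's) judgement \<Rightarrow> bool" where
  "intro_ty A J \<longleftrightarrow> (\<exists>\<Gamma>. J = (\<Gamma>, IsType (Op (Inl A) (map (Var \<circ> fst) \<Gamma>))))"

definition intro_tm :: "'s \<Rightarrow> ('o + 's) judgement \<Rightarrow> bool" where
  "intro_tm f J \<longleftrightarrow> (\<exists>\<Gamma> T. J = (\<Gamma>, OfType (Op (Inr f) (map (Var \<circ> fst) \<Gamma>)) T))"

definition gat :: "('o, 's) gat_sig \<Rightarrow> bool" where
  "gat \<T> \<longleftrightarrow>
     (\<forall>J\<in>Basic \<T>. distinct (map fst (fst J)) \<and> jsyms J \<subseteq> TyConst \<T> <+> TmConst \<T>) \<and>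
     (\<forall>A\<in>TyConst \<T>. \<exists>!J. J \<in> Basic \<T> \<and> intro_ty A J) \<and>
     (\<forall>f\<in>TmConst \<T>. \<exists>!J. J \<in> Basic \<T> \<and> intro_tm f J) \<and>
     (\<forall>J\<in>Basic \<T>. (\<exists>A\<in>TyConst \<T>. intro_ty A J) \<or> (\<exists>f\<in>TmConst \<T>. intro_tm f J) \<or>
        (\<exists>T T'. snd J = TypeEq T T') \<or> (\<exists>t t' T. snd J = TermEq t t' T)) \<and>
     Basic \<T> \<subseteq> derived (Basic \<T>)"

definition ty_jdgs :: "('o, 's) gat_sig \<Rightarrow> nat \<Rightarrow> ('o + 's) judgement set" where
  "ty_jdgs \<T> n = {J \<in> derived (Basic \<T>). degree J = n \<and> (\<exists>T. snd J = IsType T)}"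

definition tm_jdgs :: "('o, 's) gat_sig \<Rightarrow> nat \<Rightarrow> ('o + 's) judgement set" where
  "tm_jdgs \<T> n = {J \<in> derived (Basic \<T>). degree J = n \<and> (\<exists>t T. snd J = OfType t T)}"

text \<open>With zero-based indices, the \<open>i\<close>-th condition lives over the first \<open>i\<close> variables.\<close>

definition ty_equiv :: "('o, 's) gat_sig \<Rightarrow> ('o + 's) judgement rel" where
  "ty_equiv \<T> = {((\<Gamma>, IsType S), (\<Delta>, IsType T)) | \<Gamma> S \<Delta> T.
     (\<Gamma>, IsType S) \<in> derived (Basic \<T>) \<and> (\<Delta>, IsType T) \<in> derived (Basic \<T>) \<and>
     length \<Gamma> = length \<Delta> \<and>
     (\<forall>i\<le>length \<Gamma>.
        (take i \<Gamma>,
         TypeEq ((map snd \<Gamma> @ [S]) ! i)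
                (subst (renaming (map fst (take i \<Gamma>)) (map fst (take i \<Delta>)))
                   ((map snd \<Delta> @ [T]) ! i)))
        \<in> derived (Basic \<T>))}"

definition tm_equiv :: "('o, 's) gat_sig \<Rightarrow> ('o + 's) judgement rel" where
  "tm_equiv \<T> = {((\<Gamma>, OfType s S), (\<Delta>, OfType t T)) | \<Gamma> s S \<Delta> t T.
     (\<Gamma>, OfType s S) \<in> derived (Basic \<T>) \<and> (\<Delta>, OfType t T) \<in> derived (Basic \<T>) \<and>
     ((\<Gamma>, IsType S), (\<Delta>, IsType T)) \<in> ty_equiv \<T> \<and>
     (\<Gamma>, TermEq s (subst (renaming (map fst \<Gamma>) (map fst \<Delta>)) t) S) \<in> derived (Basic \<T>)}"


section \<open>Type-and-term structures\<close>

text \<open>A presheaf on the free category \<open>\<H>\<close> is a family of sets together with a function for each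
  generating arrow: \<open>Ty X n\<close> is \<open>X(n)\<close>, \<open>Tm X n\<close> is \<open>X(n\<^sub>t)\<close>, \<open>bdTy X n\<close> is the map
  \<open>X(n+1) \<rightarrow> X(n)\<close> and \<open>bdTm X n\<close> is the map \<open>X(n\<^sub>t) \<rightarrow> X(n)\<close>. The objects of \<open>\<H>\<close> have positive
  index, so the sets of index 0 are empty by convention.\<close>

record ('a, 'b) tts =
  Ty :: "nat \<Rightarrow> 'a set"
  Tm :: "nat \<Rightarrow> 'b set"
  bdTy :: "nat \<Rightarrow> 'a \<Rightarrow> 'a"
  bdTm :: "nat \<Rightarrow> 'b \<Rightarrow> 'a"

definition presheaf :: "('a, 'b) tts \<Rightarrow> bool" where
  "presheaf X \<longleftrightarrow> Ty X 0 = {} \<and> Tm X 0 = {} \<and>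
     (\<forall>n\<ge>1. bdTy X n \<in> Ty X (Suc n) \<rightarrow> Ty X n \<and> bdTm X n \<in> Tm X n \<rightarrow> Ty X n)"

definition Tm_over :: "('a, 'b) tts \<Rightarrow> nat \<Rightarrow> 'a \<Rightarrow> 'b set" where
  "Tm_over X n A = {a \<in> Tm X n. bdTm X n a = A}"

text \<open>Components of presheaf maps are extensional functions, so that equality of maps is equality
  in HOL.\<close>

type_synonym ('a, 'b, 'c, 'd) tts_map = "(nat \<Rightarrow> 'a \<Rightarrow> 'c) \<times> (nat \<Rightarrow> 'b \<Rightarrow> 'd)"

definition hom :: "('a, 'b) tts \<Rightarrow> ('c, 'd) tts \<Rightarrow> ('a, 'b, 'c, 'd) tts_map set" where
  "hom X Y = {(f, g).
     (\<forall>n. f n \<in> Ty X n \<rightarrow>\<^sub>E Ty Y n \<and> g n \<in> Tm X n \<rightarrow>\<^sub>E Tm Y n) \<and>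
     (\<forall>n\<ge>1. (\<forall>A\<in>Ty X (Suc n). f n (bdTy X n A) = bdTy Y n (f (Suc n) A)) \<and>
             (\<forall>a\<in>Tm X n. f n (bdTm X n a) = bdTm Y n (g n a)))}"

definition tts_comp ::
  "('a, 'b) tts \<Rightarrow> ('c, 'd, 'e, 'f) tts_map \<Rightarrow> ('a, 'b, 'c, 'd) tts_map \<Rightarrow> ('a, 'b, 'e, 'f) tts_map"
  where
  "tts_comp X k h = (\<lambda>n. compose (Ty X n) (fst k n) (fst h n),
                     \<lambda>n. compose (Tm X n) (snd k n) (snd h n))"

definition tts_restrict ::
  "('a, 'b) tts \<Rightarrow> ('a, 'b, 'c, 'd) tts_map \<Rightarrow> ('a, 'b, 'c, 'd) tts_map" where
  "tts_restrict X h = (\<lambda>n. restrict (fst h n) (Ty X n), \<lambda>n. restrict (snd h n) (Tm X n))"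

text \<open>\<open>bd_iter X i k\<close> is the map \<open>\<partial>\<^sup>k : X(i+k) \<rightarrow> X(i)\<close>.\<close>

primrec bd_iter :: "('a, 'b) tts \<Rightarrow> nat \<Rightarrow> nat \<Rightarrow> 'a \<Rightarrow> 'a" where
  "bd_iter X i 0 A = A"
| "bd_iter X i (Suc k) A = bd_iter X i k (bdTy X (i + k) A)"


section \<open>The forgetful functor, free theories and the unit\<close>

text \<open>The underlying structure of a theory: equivalence classes of derived judgements. The
  boundary of a class is the class of the boundary of any of its members.\<close>

definition V :: "('o, 's) gat_sig \<Rightarrow> (('o + 's) judgement set, ('o + 's) judgement set) tts" where
  "V \<T> = \<lparr>
     Ty = \<lambda>n. ty_jdgs \<T> n // ty_equiv \<T>,
     Tm = \<lambda>n. tm_jdgs \<T> n // tm_equiv \<T>,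
     bdTy = \<lambda>n c. the_elem ((\<lambda>J. ty_equiv \<T> `` {hd (boundary J)}) ` c),
     bdTm = \<lambda>n c. the_elem ((\<lambda>J. ty_equiv \<T> `` {hd (boundary J)}) ` c)\<rparr>"

text \<open>The constants of the free theory on \<open>X\<close> are the elements of \<open>X\<close>, tagged with their degree
  because the sets \<open>X(n)\<close> need not be disjoint. The variable \<open>x\<^sub>i\<close> is the number \<open>i\<close>.\<close>

type_synonym ('a, 'b) free_sym = "(nat \<times> 'a) + (nat \<times> 'b)"

definition free_ty :: "nat \<Rightarrow> 'a \<Rightarrow> ('a, 'b) free_sym exp" where
  "free_ty n A = Op (Inl (n, A)) (map Var [1..<n])"

definition free_ctx :: "('a, 'b) tts \<Rightarrow> nat \<Rightarrow> 'a \<Rightarrow> ('a, 'b) free_sym ctx" where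
  "free_ctx X n A = map (\<lambda>i. (i, free_ty i (bd_iter X i (n - i) A))) [1..<n]"

definition ty_axiom :: "('a, 'b) tts \<Rightarrow> nat \<Rightarrow> 'a \<Rightarrow> ('a, 'b) free_sym judgement" where
  "ty_axiom X n A = (free_ctx X n A, IsType (free_ty n A))"

definition tm_axiom :: "('a, 'b) tts \<Rightarrow> nat \<Rightarrow> 'b \<Rightarrow> ('a, 'b) free_sym judgement" where
  "tm_axiom X n a = (free_ctx X n (bdTm X n a),
     OfType (Op (Inr (n, a)) (map Var [1..<n])) (free_ty n (bdTm X n a)))"

definition free_gat :: "('a, 'b) tts \<Rightarrow> (nat \<times> 'a, nat \<times> 'b) gat_sig" where
  "free_gat X = \<lparr>
     TyConst = Sigma UNIV (Ty X),
     TmConst = Sigma UNIV (Tm X),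
     Basic = {ty_axiom X n A | n A. A \<in> Ty X n} \<union> {tm_axiom X n a | n a. a \<in> Tm X n}\<rparr>"

lemma free_basic: "Basic (free_gat X) = {ty_axiom X n A | n A. A \<in> Ty X n} \<union> {tm_axiom X n a | n a. a \<in> Tm X n}"
  by (simp add: free_gat_def)

lemma free_ctx_fst: "map fst (free_ctx X n A) = [1..<n]"
  by (auto simp: free_ctx_def comp_def)

lemma free_ctx_Suc: "1 \<le> n \<Longrightarrow> free_ctx X (Suc n) A = free_ctx X n (bdTy X n A) @ [(n, free_ty n (bdTy X n A))]"
  by (auto simp: free_ctx_def Suc_diff_le)

lemma ty_axiom_derived: "presheaf X \<Longrightarrow> A \<in> Ty X n \<Longrightarrow> ty_axiom X n A \<in> derived (Basic (free_gat X))"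
proof (induction n arbitrary: A)
  case 0 then show ?case by (auto simp: presheaf_def)
next
  case (Suc n)
  show ?case
  proof (rule derived.basic)
    show "ty_axiom X (Suc n) A \<in> Basic (free_gat X)" using Suc by (auto simp: free_basic)
    fix J' assume J: "J' \<in> set (boundary (ty_axiom X (Suc n) A))"
    then have n: "1 \<le> n" by (cases n) (auto simp: ty_axiom_def free_ctx_def)
    then have "J' = ty_axiom X n (bdTy X n A)" using J by (simp add: ty_axiom_def free_ctx_Suc)
    moreover have "bdTy X n A \<in> Ty X n" using Suc n by (auto simp: presheaf_def Pi_def)
    ultimately show "J' \<in> derived (Basic (free_gat X))" using Suc by auto
  qed
qed

lemma tm_axiom_derived: "presheaf X \<Longrightarrow> a \<in> Tm X n \<Longrightarrow> tm_axiom X n a \<in> derived (Basic (free_gat X))"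
proof (rule derived.basic)
  assume p: "presheaf X" "a \<in> Tm X n"
  then have "1 \<le> n" by (cases n) (auto simp: presheaf_def)
  then have "bdTm X n a \<in> Ty X n" using p by (auto simp: presheaf_def Pi_def)
  fix J' assume J: "J' \<in> set (boundary (tm_axiom X n a))"
  then show "J' \<in> derived (Basic (free_gat X))" using ty_axiom_derived[OF p(1) \<open>bdTm X n a \<in> Ty X n\<close>] by (simp add: tm_axiom_def ty_axiom_def)
qed (auto simp: free_basic)

lemma gat_free_gat:
  assumes "presheaf X" shows "gat (free_gat X)"
proof -
  have e: "map (Var \<circ> fst) (free_ctx X n A) = map Var [1..<n]" for n A
    by (auto simp: free_ctx_def)
  have bi: "1 \<le> i \<Longrightarrow> A \<in> Ty X (i + k) \<Longrightarrow> bd_iter X i k A \<in> Ty X i" for i k A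
    using assms by (induction k arbitrary: A) (auto simp: presheaf_def Pi_def)
  have s: "jsyms (ty_axiom X n A) \<subseteq> Sigma UNIV (Ty X) <+> Sigma UNIV (Tm X)" if "A \<in> Ty X n" for n A
  proof -
    have "bd_iter X i (n - i) A \<in> Ty X i" if "i \<in> {1..<n}" for i
      using that \<open>A \<in> Ty X n\<close> by (intro bi) auto
    then show ?thesis using that by (auto simp: jsyms_def ty_axiom_def free_ctx_def free_ty_def)
  qed
  have st: "jsyms (tm_axiom X n a) \<subseteq> Sigma UNIV (Ty X) <+> Sigma UNIV (Tm X)" if "a \<in> Tm X n" for n a
  proof -
    have "1 \<le> n" using assms that by (cases n) (auto simp: presheaf_def)
    then have "bdTm X n a \<in> Ty X n" using assms that by (auto simp: presheaf_def Pi_def)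
    from s[OF this] show ?thesis using that by (auto simp: jsyms_def tm_axiom_def ty_axiom_def free_ty_def)
  qed
  have it: "intro_ty A (ty_axiom X n B) \<longleftrightarrow> A = (n,B)" for A n B
    by (auto simp: intro_ty_def ty_axiom_def free_ty_def e)
  have it2: "\<not> intro_ty A (tm_axiom X n b)" for A n b
    by (auto simp: intro_ty_def tm_axiom_def)
  have im: "intro_tm f (tm_axiom X n a) \<longleftrightarrow> f = (n,a)" for f n a
    by (auto simp: intro_tm_def tm_axiom_def e)
  have im2: "\<not> intro_tm f (ty_axiom X n A)" for f n A
    by (auto simp: intro_tm_def ty_axiom_def)
  have d: "J \<in> Basic (free_gat X) \<Longrightarrow> distinct (map fst (fst J))" for J
    by (auto simp: free_basic ty_axiom_def tm_axiom_def free_ctx_fst)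
  have dv: "Basic (free_gat X) \<subseteq> derived (Basic (free_gat X))"
    using ty_axiom_derived[OF assms] tm_axiom_derived[OF assms] by (auto simp: free_basic)
  show ?thesis unfolding gat_def
  proof (intro conjI ballI)
    fix J assume J: "J \<in> Basic (free_gat X)"
    show "distinct (map fst (fst J))" using d J .
    show "jsyms J \<subseteq> TyConst (free_gat X) <+> TmConst (free_gat X)" using J s st by (fastforce simp: free_gat_def)
    show "(\<exists>A\<in>TyConst (free_gat X). intro_ty A J) \<or> (\<exists>f\<in>TmConst (free_gat X). intro_tm f J) \<or>
        (\<exists>T T'. snd J = TypeEq T T') \<or> (\<exists>t t' T. snd J = TermEq t t' T)"
      using J by (auto simp: free_gat_def it im)
  next
    fix A assume "A \<in> TyConst (free_gat X)"
    then show "\<exists>!J. J \<in> Basic (free_gat X) \<and> intro_ty A J"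
      by (cases A) (auto simp: free_gat_def it it2 intro!: ex1I[of _ "ty_axiom X (fst A) (snd A)"])
  next
    fix A assume "A \<in> TmConst (free_gat X)"
    then show "\<exists>!J. J \<in> Basic (free_gat X) \<and> intro_tm A J"
      by (cases A) (auto simp: free_gat_def im im2 intro!: ex1I[of _ "tm_axiom X (fst A) (snd A)"])
  qed (rule dv)
qed

text \<open>The unit \<open>X \<rightarrow> V(GX)\<close> of the free-forgetful adjunction.\<close>

definition free_unit :: "('a, 'b) tts \<Rightarrow>
    ('a, 'b, ('a, 'b) free_sym judgement set, ('a, 'b) free_sym judgement set) tts_map" where
  "free_unit X = (\<lambda>n. \<lambda>A\<in>Ty X n. ty_equiv (free_gat X) `` {ty_axiom X n A},
                  \<lambda>n. \<lambda>a\<in>Tm X n. tm_equiv (free_gat X) `` {tm_axiom X n a})"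


section \<open>The description of the substitution monad by inc-lists\<close>

definition inc :: "nat \<Rightarrow> (nat \<Rightarrow> nat) set" where
  "inc n = {\<alpha> \<in> extensional {0..n}. strict_mono_on {0..n} \<alpha> \<and> \<alpha> 0 = 0}"

text \<open>The presheaf \<open>[\<alpha>]\<close> for \<open>\<alpha> \<in> Inc(n)\<close>; its elements \<open>i\<close> and \<open>i\<^sub>t\<close> are both represented by the
  number \<open>i\<close>.\<close>

definition cell :: "nat \<Rightarrow> (nat \<Rightarrow> nat) \<Rightarrow> (nat, nat) tts" where
  "cell n \<alpha> = \<lparr>
     Ty = \<lambda>i. if 1 \<le> i \<and> i \<le> \<alpha> n then {i} else {},
     Tm = \<lambda>i. if 1 \<le> i \<and> i \<le> \<alpha> n \<and> i \<notin> \<alpha> ` {0..n} then {i} else {},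
     bdTy = \<lambda>i _. i,
     bdTm = \<lambda>i _. i\<rparr>"

type_synonym ('a, 'b) inc_elem = "(nat \<Rightarrow> nat) \<times> (nat, nat, 'a, 'b) tts_map"

definition inc_elems :: "('a, 'b) tts \<Rightarrow> nat \<Rightarrow> ('a, 'b) inc_elem set" where
  "inc_elems X n = (if n = 0 then {} else SIGMA \<alpha> : inc n. hom (cell n \<alpha>) X)"

text \<open>The value at \<open>X\<close> of the substitution monad, described by inc-lists.
  An element of \<open>SX(n\<^sub>t)\<close> is a pair of its boundary \<open>(\<alpha>, h)\<close> and an element \<open>a\<close> of
  \<open>Tm\<^sub>X(h(\<alpha>(n)))\<close>.\<close>

definition subst_monad :: "('a, 'b) tts \<Rightarrow> (('a, 'b) inc_elem, ('a, 'b) inc_elem \<times> 'b) tts" where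
  "subst_monad X = \<lparr>
     Ty = inc_elems X,
     Tm = \<lambda>n. SIGMA (\<alpha>, h) : inc_elems X n. Tm_over X (\<alpha> n) (fst h (\<alpha> n) (\<alpha> n)),
     bdTy = \<lambda>n (\<alpha>, h). (restrict \<alpha> {0..n}, tts_restrict (cell n (restrict \<alpha> {0..n})) h),
     bdTm = \<lambda>n. fst\<rparr>"

text \<open>The expressions \<open>e\<^sub>j\<close> and \<open>T\<^sub>i\<close>, and the identification of \<open>subst_monad X\<close> with \<open>V (free_gat X)\<close>.\<close>

fun inc_exp ::
  "nat \<Rightarrow> (nat \<Rightarrow> nat) \<Rightarrow> (nat, nat, 'a, 'b) tts_map \<Rightarrow> nat \<Rightarrow> ('a, 'b) free_sym exp" where
  "inc_exp n \<alpha> h j =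
     (if j \<in> \<alpha> ` {0..n} then Var (THE m. m \<le> n \<and> \<alpha> m = j)
      else Op (Inr (j, snd h j j)) (map (inc_exp n \<alpha> h) [1..<j]))"

declare inc_exp.simps [simp del]

definition inc_ty ::
  "nat \<Rightarrow> (nat \<Rightarrow> nat) \<Rightarrow> (nat, nat, 'a, 'b) tts_map \<Rightarrow> nat \<Rightarrow> ('a, 'b) free_sym exp" where
  "inc_ty n \<alpha> h i = Op (Inl (\<alpha> i, fst h (\<alpha> i) (\<alpha> i))) (map (inc_exp n \<alpha> h) [1..<\<alpha> i])"

definition inc_ctx ::
  "nat \<Rightarrow> (nat \<Rightarrow> nat) \<Rightarrow> (nat, nat, 'a, 'b) tts_map \<Rightarrow> ('a, 'b) free_sym ctx" where
  "inc_ctx n \<alpha> h = map (\<lambda>i. (i, inc_ty n \<alpha> h i)) [1..<n]"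

definition ident :: "('a, 'b) tts \<Rightarrow>
    (('a, 'b) inc_elem, ('a, 'b) inc_elem \<times> 'b,
     ('a, 'b) free_sym judgement set, ('a, 'b) free_sym judgement set) tts_map" where
  "ident X =
     (\<lambda>n. \<lambda>(\<alpha>, h)\<in>Ty (subst_monad X) n.
        ty_equiv (free_gat X) `` {(inc_ctx n \<alpha> h, IsType (inc_ty n \<alpha> h n))},
      \<lambda>n. \<lambda>((\<alpha>, h), a)\<in>Tm (subst_monad X) n.
        tm_equiv (free_gat X) ``
          {(inc_ctx n \<alpha> h,
            OfType (Op (Inr (\<alpha> n, a)) (map (inc_exp n \<alpha> h) [1..<\<alpha> n])) (inc_ty n \<alpha> h n))})"

definition iota :: "nat \<Rightarrow> nat \<Rightarrow> nat" where
  "iota n = (\<lambda>i\<in>{0..n}. i)"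

text \<open>The presheaf \<open>[\<iota>\<^sub>n]\<close> has no term-elements, so \<open>tilde X n A\<close> is determined by its action on
  type-elements.\<close>

definition tilde :: "('a, 'b) tts \<Rightarrow> nat \<Rightarrow> 'a \<Rightarrow> (nat, nat, 'a, 'b) tts_map" where
  "tilde X n A = (\<lambda>i. \<lambda>j\<in>Ty (cell n (iota n)) i. bd_iter X i (n - i) A, \<lambda>i j. undefined)"

end

theory Submission
  imports Defs
begin

text \<open>The free theory \<open>GX\<close> has no equality axioms, and no deduction rule creates an equality between
  distinct expressions out of reflexive ones. So every equality derived in \<open>GX\<close> is between
  syntactically equal expressions (\<open>derived_TypeEqD\<close>, \<open>derived_TermEqD\<close>), and two derived judgements
  are equivalent exactly when they agree up to renaming the variables of their contexts
  (\<open>ty_equiv_iff\<close>). An element of \<open>V(GX)\<close> therefore remembers every constant that occurs in a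
  representative, and both halves of the theorem are read off from this.

  On the one hand, the boundary of a class is well defined because taking boundaries respects
  renaming (\<open>ty_equiv_boundary\<close>). The boundary of an axiom of \<open>GX\<close> is the axiom of the
  boundary, so \<open>free_unit X\<close> is a map of presheaves (\<open>free_unit_hom\<close>).

  On the other hand, the inc-list \<open>\<iota>\<^sub>n\<close> skips no index. All its expressions \<open>e\<^sub>j\<close> are the variables
  \<open>x\<^sub>j\<close>, and the judgement described by \<open>(\<iota>\<^sub>n, tilde A)\<close> is literally the axiom of \<open>A\<close>
  (\<open>inc_ctx_tilde\<close>, \<open>inc_ty_tilde\<close>); this makes the stated formula a factorization of the unit through the
  identification. It is the only one. If \<open>(\<alpha>, h)\<close> describes a judgement equivalent to the axiom of
  \<open>A\<close>, comparing the outermost constants of the \<open>i\<close>-th types, which record \<open>\<alpha>(i)\<close> and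
  \<open>h(\<alpha>(i))\<close> on one side and \<open>i\<close> and \<open>\<partial>\<^sup>n\<^sup>-\<^sup>i A\<close> on the other, forces \<open>\<alpha> = \<iota>\<^sub>n\<close> and
  \<open>h = tilde A\<close> (\<open>inc_list_of_axiom\<close>).\<close>

section \<open>Substitution and renaming\<close>

primrec vars :: "'c exp \<Rightarrow> var set" where
  "vars (Var x) = {x}"
| "vars (Op w es) = \<Union> (set (map vars es))"

lemma subst_cong: "(\<And>x. x \<in> vars e \<Longrightarrow> s x = s' x) \<Longrightarrow> subst s e = subst s' e"
  by (induction e) (auto intro!: map_cong)

lemma subst_Var: "subst Var e = e"
  by (induction e) (auto intro!: map_idI)

lemma subst_subst: "subst s (subst s' e) = subst (\<lambda>x. subst s (s' x)) e"
  by (induction e) auto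

lemma vars_subst: "vars (subst s e) = (\<Union>x\<in>vars e. vars (s x))"
  by (induction e) auto

lemma renaming_nth:
  assumes "distinct ys" "length xs = length ys" "k < length ys"
  shows "renaming xs ys (ys ! k) = Var (xs ! k)"
proof -
  have "map_of (zip ys xs) (ys ! k) = Some (xs ! k)"
    using assms by (auto simp: map_of_zip_nth)
  then show ?thesis by (simp add: renaming_def)
qed

lemma renaming_self: "renaming xs xs = Var"
proof
  fix y
  have "map_of (zip xs xs) y = Some x \<Longrightarrow> x = y" for x
    by (drule map_of_SomeD) (auto simp: in_set_zip)
  then show "renaming xs xs y = Var y"
    by (auto simp: renaming_def split: option.split)
qed

lemma subst_renaming_trans:
  assumes "distinct ys" "distinct zs" "length xs = length ys" "length ys = length zs"
    and "vars e \<subseteq> set zs"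
  shows "subst (renaming xs ys) (subst (renaming ys zs) e) = subst (renaming xs zs) e"
  unfolding subst_subst
proof (rule subst_cong)
  fix z assume "z \<in> vars e"
  then obtain k where "k < length zs" "z = zs ! k"
    using assms(5) by (metis in_set_conv_nth subsetD)
  then show "subst (renaming xs ys) (renaming ys zs z) = renaming xs zs z"
    using assms by (simp add: renaming_nth)
qed

lemma vars_single: "vars (subst (single y t) e) \<subseteq> (vars e - {y}) \<union> vars t"
  by (auto simp: vars_subst single_def split: if_splits)

lemma fst_subst_ctx: "map fst (subst_ctx s \<Delta>) = map fst \<Delta>"
  by (auto simp: subst_ctx_def)

lemma fst_perm_ctx: "map fst (perm_ctx \<sigma> \<Delta>) = map \<sigma> (map fst \<Delta>)"
  by (auto simp: perm_ctx_def)

text \<open>An entry of the context produced by the substitution rule sits either in the untouched part or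
  in the substituted one.\<close>

lemma append_subst_ctx_eq:
  assumes "\<Gamma> @ subst_ctx s \<Delta> = \<Gamma>' @ (x, S) # \<Gamma>''"
  shows "(\<exists>\<Theta>. \<Gamma> = \<Gamma>' @ (x, S) # \<Theta>) \<or>
    (\<exists>\<Delta>' S' \<Delta>''. \<Delta> = \<Delta>' @ (x, S') # \<Delta>'' \<and> S = subst s S' \<and> \<Gamma>' = \<Gamma> @ subst_ctx s \<Delta>')"
proof -
  have tail: ?thesis if "subst_ctx s \<Delta> = us @ (x, S) # \<Gamma>''" "\<Gamma>' = \<Gamma> @ us" for us
  proof -
    from that(1) obtain \<Delta>' S' \<Delta>'' where
      "\<Delta> = \<Delta>' @ (x, S') # \<Delta>''" "S = subst s S'" "us = subst_ctx s \<Delta>'"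
      unfolding subst_ctx_def by (auto simp: map_eq_append_conv)
    then show ?thesis using that(2) by auto
  qed
  consider us where "\<Gamma> = \<Gamma>' @ us" "us @ subst_ctx s \<Delta> = (x, S) # \<Gamma>''"
    | us where "\<Gamma> @ us = \<Gamma>'" "subst_ctx s \<Delta> = us @ (x, S) # \<Gamma>''"
    using assms unfolding append_eq_append_conv2 by blast
  then show ?thesis
  proof cases
    case 1
    then show ?thesis using tail[of "[]"] by (cases us) auto
  next
    case 2
    then show ?thesis using tail[of us] by simp
  qed
qed

section \<open>Theories without equality axioms\<close>

locale equation_free_gat =
  fixes \<T> :: "('o, 's) gat_sig"
  assumes gat: "gat \<T>"
    and no_equation:
      "J \<in> Basic \<T> \<Longrightarrow> (\<exists>T. snd J = IsType T) \<or> (\<exists>t T. snd J = OfType t T)"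
begin

abbreviation \<D> :: "('o + 's) judgement set" where
  "\<D> \<equiv> derived (Basic \<T>)"

text \<open>Both congruence rules turn an equality \<open>t\<^sub>1 = t\<^sub>2\<close> into an equality of two instances of one
  expression; if \<open>t\<^sub>1\<close> and \<open>t\<^sub>2\<close> are the same expression, so are the instances.\<close>

lemma derived_equality:
  assumes "J \<in> \<D>"
  shows "case snd J of TypeEq T T' \<Rightarrow> T = T' | TermEq t t' T \<Rightarrow> t = t' | _ \<Rightarrow> True"
  using assms
proof (induction rule: derived.induct)
  case (basic J)
  then show ?case using no_equation[of J] by auto
next
  case (alpha \<Gamma> R \<sigma>)
  then show ?case by (cases R) auto
next
  case (substitution \<Gamma> t T y \<Delta> R)
  then show ?case by (cases R) auto
qed auto

lemma derived_TypeEqD: "(\<Gamma>, TypeEq T T') \<in> \<D> \<Longrightarrow> T = T'"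
  using derived_equality by fastforce

lemma derived_TermEqD: "(\<Gamma>, TermEq t t' T) \<in> \<D> \<Longrightarrow> t = t'"
  using derived_equality by fastforce

text \<open>The right-hand side alone carries the induction: substituting \<open>t\<close> for \<open>y\<close> trades
  \<open>y\<close> for variables of \<open>t\<close>, which lie in the untouched part of the context. The context types
  are covered later, being themselves derived types over the preceding entries.\<close>

lemma derived_scoped:
  assumes "J \<in> \<D>"
  shows "distinct (map fst (fst J)) \<and> (\<forall>e\<in>set_rhs (snd J). vars e \<subseteq> set (map fst (fst J)))"
  using assms
proof (induction rule: derived.induct)
  case (basic J)
  obtain \<Gamma> R where J: "J = (\<Gamma>, R)" by (cases J)
  have "distinct (map fst \<Gamma>)" using gat basic.hyps(1) J unfolding gat_def by fastforce
  \<comment> \<open>The subject of \<open>J\<close> is a constant applied to the variables of its own context; its type, if it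
    has one, is covered by the boundary.\<close>
  moreover have "(\<exists>A. intro_ty A J) \<or> (\<exists>f. intro_tm f J)"
    using gat basic.hyps(1) no_equation[of J] unfolding gat_def by fastforce
  ultimately show ?case using basic.IH by (auto simp: intro_ty_def intro_tm_def J) force+
next
  case (alpha \<Gamma> R \<sigma>)
  have "inj \<sigma>" using alpha.hyps by (simp add: bij_is_inj)
  then have "distinct (map \<sigma> (map fst \<Gamma>))"
    using alpha.IH inj_on_subset[OF _ subset_UNIV] by (simp add: distinct_map del: map_map)
  then show ?case
    using alpha.IH by (fastforce simp: fst_perm_ctx rhs.set_map vars_subst simp del: map_map)
next
  case (substitution \<Gamma> t T y \<Delta> R)
  then show ?case using vars_single[of y t]
    by (auto simp: fst_subst_ctx rhs.set_map) blast+
next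
  case (ty_cong \<Gamma> t1 t2 T y \<Delta> T')
  then show ?case using vars_single[of y t1 T'] vars_single[of y t2 T']
    by (auto simp: fst_subst_ctx)
next
  case (tm_cong \<Gamma> t1 t2 T y \<Delta> t' T')
  then show ?case
    using vars_single[of y t1 t'] vars_single[of y t2 t'] vars_single[of y t2 T']
    by (auto simp: fst_subst_ctx)
qed auto

text \<open>Both the boundary of a type judgement and the comparison of context entries over truncated
  contexts pass to a context entry as a type of its own; the entries must be derived for that.\<close>

definition ctx_derived :: "('o + 's) ctx \<Rightarrow> bool" where
  "ctx_derived \<Gamma> \<longleftrightarrow> (\<forall>\<Gamma>' x S \<Gamma>''. \<Gamma> = \<Gamma>' @ (x, S) # \<Gamma>'' \<longrightarrow> (\<Gamma>', IsType S) \<in> \<D>)"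

lemma ctx_derivedD: "ctx_derived (\<Gamma>' @ (x, S) # \<Gamma>'') \<Longrightarrow> (\<Gamma>', IsType S) \<in> \<D>"
  by (simp add: ctx_derived_def)

lemma ctx_derived_prefix: "ctx_derived (\<Gamma> @ \<Delta>) \<Longrightarrow> ctx_derived \<Gamma>"
  by (auto simp: ctx_derived_def)

lemma ctx_derived_snoc:
  assumes "ctx_derived \<Gamma>" "(\<Gamma>, IsType T) \<in> \<D>"
  shows "ctx_derived (\<Gamma> @ [(y, T)])"
  unfolding ctx_derived_def
proof (intro allI impI)
  fix \<Gamma>' x S \<Gamma>''
  assume eq: "\<Gamma> @ [(y, T)] = \<Gamma>' @ (x, S) # \<Gamma>''"
  show "(\<Gamma>', IsType S) \<in> \<D>"
  proof (cases \<Gamma>'' rule: rev_cases)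
    case Nil
    then show ?thesis using eq assms(2) by simp
  next
    case (snoc \<Theta> c)
    then have "\<Gamma> = \<Gamma>' @ (x, S) # \<Theta>" using eq by simp
    then show ?thesis using assms(1) by (simp add: ctx_derivedD)
  qed
qed

lemma ctx_derived_perm:
  assumes "ctx_derived \<Gamma>" "bij \<sigma>"
  shows "ctx_derived (perm_ctx \<sigma> \<Gamma>)"
  unfolding ctx_derived_def
proof (intro allI impI)
  fix \<Gamma>' x S \<Gamma>''
  assume eq: "perm_ctx \<sigma> \<Gamma> = \<Gamma>' @ (x, S) # \<Gamma>''"
  obtain \<Delta>' z U \<Delta>'' where *: "\<Gamma> = \<Delta>' @ (z, U) # \<Delta>''" "\<Gamma>' = perm_ctx \<sigma> \<Delta>'"
    "S = subst (\<lambda>z. Var (\<sigma> z)) U"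
    using eq unfolding perm_ctx_def by (auto simp: map_eq_append_conv)
  then have "(\<Delta>', IsType U) \<in> \<D>" using assms(1) by (simp add: ctx_derivedD)
  from derived.alpha[OF this assms(2)] show "(\<Gamma>', IsType S) \<in> \<D>" using * by simp
qed

lemma ctx_derived_subst:
  assumes t: "(\<Gamma>, OfType t T) \<in> \<D>" and ctx: "ctx_derived (\<Gamma> @ (y, T) # \<Delta>)"
  shows "ctx_derived (\<Gamma> @ subst_ctx (single y t) \<Delta>)"
  unfolding ctx_derived_def
proof (intro allI impI)
  fix \<Gamma>' x S \<Gamma>''
  assume "\<Gamma> @ subst_ctx (single y t) \<Delta> = \<Gamma>' @ (x, S) # \<Gamma>''"
  from append_subst_ctx_eq[OF this] show "(\<Gamma>', IsType S) \<in> \<D>"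
  proof (elim disjE exE conjE)
    fix \<Theta> assume "\<Gamma> = \<Gamma>' @ (x, S) # \<Theta>"
    then show ?thesis using ctx_derived_prefix[OF ctx] by (simp add: ctx_derivedD)
  next
    fix \<Delta>' S' \<Delta>''
    assume *: "\<Delta> = \<Delta>' @ (x, S') # \<Delta>''" "S = subst (single y t) S'"
      "\<Gamma>' = \<Gamma> @ subst_ctx (single y t) \<Delta>'"
    then have "(\<Gamma> @ (y, T) # \<Delta>', IsType S') \<in> \<D>"
      using ctx ctx_derivedD[of "\<Gamma> @ (y, T) # \<Delta>'" x S' \<Delta>''] by simp
    from derived.substitution[OF t this] show ?thesis using * by simp
  qed
qed

text \<open>The second conjunct is carried along for the sake of the first: the congruence rules
  substitute into the context a term \<open>t\<^sub>2\<close> known only from an equality \<open>t\<^sub>1 = t\<^sub>2 : T\<close>, and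
  \<open>ctx_derived_subst\<close> asks for \<open>t\<^sub>2 : T\<close> itself. That \<open>t\<^sub>1\<close> and \<open>t\<^sub>2\<close> coincide lets every equality
  step pass from \<open>t\<^sub>1 : T\<close> to \<open>t\<^sub>2 : T\<close>.\<close>

lemma derived_ctx_and_term:
  assumes "J \<in> \<D>"
  shows "ctx_derived (fst J) \<and>
    (case snd J of TermEq t t' T \<Rightarrow> (fst J, OfType t T) \<in> \<D> | _ \<Rightarrow> True)"
  using assms
proof (induction rule: derived.induct)
  case (basic J)
  obtain \<Gamma> R where J: "J = (\<Gamma>, R)" by (cases J)
  consider T where "R = IsType T" | t T where "R = OfType t T"
    using no_equation[OF basic.hyps(1)] J by auto
  then show ?case
  proof cases
    case 1
    show ?thesis
    proof (cases \<Gamma> rule: rev_cases)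
      case Nil
      then show ?thesis using J 1 by (simp add: ctx_derived_def)
    next
      case (snoc \<Gamma>0 b)
      have "(\<Gamma>0, IsType (snd b)) \<in> set (boundary J)" using J 1 snoc by simp
      from basic.IH[OF this] basic.hyps(2)[OF this] show ?thesis
        using J 1 snoc ctx_derived_snoc[of \<Gamma>0 "snd b" "fst b"] by simp
    qed
  next
    case 2
    then have "(\<Gamma>, IsType T) \<in> set (boundary J)" using J by simp
    from basic.IH[OF this] show ?thesis using J 2 by simp
  qed
next
  case (tm_sym \<Gamma> t1 t2 T)
  then show ?case by (auto dest: derived_TermEqD)
next
  case (tm_eq_conv \<Gamma> T1 T2 t1 t2)
  then show ?case by (auto dest: derived_TypeEqD)
next
  case (alpha \<Gamma> R \<sigma>)
  have "(perm_ctx \<sigma> \<Gamma>, OfType (subst (\<lambda>z. Var (\<sigma> z)) t) (subst (\<lambda>z. Var (\<sigma> z)) T)) \<in> \<D>"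
    if "R = TermEq t t' T" for t t' T
    using derived.alpha[of \<Gamma> "OfType t T" "Basic \<T>" \<sigma>] alpha.IH alpha.hyps that by simp
  then show ?case using alpha.IH alpha.hyps by (cases R) (auto intro: ctx_derived_perm)
next
  case (substitution \<Gamma> t T y \<Delta> R)
  have "(\<Gamma> @ subst_ctx (single y t) \<Delta>,
      OfType (subst (single y t) u) (subst (single y t) U)) \<in> \<D>"
    if "R = TermEq u u' U" for u u' U
    using derived.substitution[OF substitution.hyps(1), of y \<Delta> "OfType u U"]
      substitution.IH that by simp
  then show ?case
    using substitution.IH substitution.hyps by (cases R) (auto intro: ctx_derived_subst)
next
  case (ty_cong \<Gamma> t1 t2 T y \<Delta> T')
  have "t1 = t2" using ty_cong.hyps by (auto dest: derived_TermEqD)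
  then show ?case using ty_cong.IH by (auto intro: ctx_derived_subst)
next
  case (tm_cong \<Gamma> t1 t2 T y \<Delta> t' T')
  have t: "t1 = t2" using tm_cong.hyps by (auto dest: derived_TermEqD)
  then have "(\<Gamma>, OfType t2 T) \<in> \<D>" using tm_cong.IH by simp
  from derived.substitution[OF this tm_cong.hyps(2)] this t show ?case
    using tm_cong.IH by (auto intro: ctx_derived_subst)
qed auto

lemma derived_entry:
  assumes "(\<Gamma>, IsType S) \<in> \<D>" "i \<le> length \<Gamma>"
  shows "(take i \<Gamma>, IsType ((map snd \<Gamma> @ [S]) ! i)) \<in> \<D>"
proof (cases "i = length \<Gamma>")
  case True
  then show ?thesis using assms by (simp add: nth_append)
next
  case False
  then have "\<Gamma> = take i \<Gamma> @ (fst (\<Gamma> ! i), snd (\<Gamma> ! i)) # drop (Suc i) \<Gamma>"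
    using assms by (simp add: id_take_nth_drop)
  moreover have "ctx_derived \<Gamma>" using derived_ctx_and_term[OF assms(1)] by simp
  ultimately have "(take i \<Gamma>, IsType (snd (\<Gamma> ! i))) \<in> \<D>" by (metis ctx_derivedD)
  then show ?thesis using assms False by (simp add: nth_append)
qed

text \<open>Equivalence is \<open>\<alpha>\<close>-equivalence: a derived equality forces the two types to coincide after
  renaming, and conversely reflexivity applies because each context entry is a derived type
  (\<open>derived_entry\<close>).\<close>

lemma ty_equiv_iff:
  "((\<Gamma>, IsType S), (\<Delta>, IsType T)) \<in> ty_equiv \<T> \<longleftrightarrow>
     (\<Gamma>, IsType S) \<in> \<D> \<and> (\<Delta>, IsType T) \<in> \<D> \<and> length \<Gamma> = length \<Delta> \<and>
     (\<forall>i\<le>length \<Gamma>. (map snd \<Gamma> @ [S]) ! i =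
        subst (renaming (map fst (take i \<Gamma>)) (map fst (take i \<Delta>))) ((map snd \<Delta> @ [T]) ! i))"
  (is "?L \<longleftrightarrow> ?R")
proof
  assume ?L
  then show ?R by (auto simp: ty_equiv_def dest: derived_TypeEqD)
next
  assume r: ?R
  have "(take i \<Gamma>, TypeEq ((map snd \<Gamma> @ [S]) ! i) ((map snd \<Gamma> @ [S]) ! i)) \<in> \<D>"
    if "i \<le> length \<Gamma>" for i
    using derived_entry[OF _ that] r by (auto intro: derived.ty_refl)
  then show ?L using r by (auto simp: ty_equiv_def)
qed

lemma ty_equivE:
  assumes "(J, K) \<in> ty_equiv \<T>"
  obtains \<Gamma> S \<Delta> T where "J = (\<Gamma>, IsType S)" "K = (\<Delta>, IsType T)"
  using assms by (auto simp: ty_equiv_def)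

lemma ty_equiv_refl: "(\<Gamma>, IsType S) \<in> \<D> \<Longrightarrow> ((\<Gamma>, IsType S), (\<Gamma>, IsType S)) \<in> ty_equiv \<T>"
  by (simp add: ty_equiv_iff renaming_self subst_Var)

lemma distinct_names: "(\<Gamma>, R) \<in> \<D> \<Longrightarrow> distinct (map fst (take i \<Gamma>))"
  using derived_scoped[of "(\<Gamma>, R)"] by (simp add: take_map[symmetric] distinct_take)

text \<open>This is what lets a renaming be undone: it acts on an entry only through the names of the
  preceding variables, which are distinct.\<close>

lemma vars_entry:
  assumes "(\<Gamma>, IsType S) \<in> \<D>" "i \<le> length \<Gamma>"
  shows "vars ((map snd \<Gamma> @ [S]) ! i) \<subseteq> set (map fst (take i \<Gamma>))"
  using derived_scoped[OF derived_entry[OF assms]] by simp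

lemma ty_equiv_trans: "trans (ty_equiv \<T>)"
proof (rule transI)
  fix J K L assume JK: "(J, K) \<in> ty_equiv \<T>" and KL: "(K, L) \<in> ty_equiv \<T>"
  obtain \<Gamma> S \<Delta> T where J: "J = (\<Gamma>, IsType S)" and K: "K = (\<Delta>, IsType T)"
    by (rule ty_equivE[OF JK])
  obtain \<Theta> U where L: "L = (\<Theta>, IsType U)" using KL by (auto elim: ty_equivE)
  note jk = JK[unfolded J K ty_equiv_iff] and kl = KL[unfolded K L ty_equiv_iff]
  have "(map snd \<Gamma> @ [S]) ! i =
      subst (renaming (map fst (take i \<Gamma>)) (map fst (take i \<Theta>))) ((map snd \<Theta> @ [U]) ! i)"
    if i: "i \<le> length \<Gamma>" for i
  proof -
    have "(map snd \<Gamma> @ [S]) ! i = subst (renaming (map fst (take i \<Gamma>)) (map fst (take i \<Delta>)))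
        (subst (renaming (map fst (take i \<Delta>)) (map fst (take i \<Theta>))) ((map snd \<Theta> @ [U]) ! i))"
      using jk kl i by metis
    also have "\<dots> = subst (renaming (map fst (take i \<Gamma>)) (map fst (take i \<Theta>)))
        ((map snd \<Theta> @ [U]) ! i)"
      by (rule subst_renaming_trans)
        (use jk kl i distinct_names[of \<Delta> "IsType T" i]
          distinct_names[of \<Theta> "IsType U" i]
          vars_entry[of \<Theta> U i] in simp_all)
    finally show ?thesis .
  qed
  then show "(J, L) \<in> ty_equiv \<T>" unfolding J L ty_equiv_iff using jk kl by auto
qed

lemma ty_equiv_sym: "sym (ty_equiv \<T>)"
proof (rule symI)
  fix J K assume JK: "(J, K) \<in> ty_equiv \<T>"
  obtain \<Gamma> S \<Delta> T where J: "J = (\<Gamma>, IsType S)" and K: "K = (\<Delta>, IsType T)"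
    by (rule ty_equivE[OF JK])
  note jk = JK[unfolded J K ty_equiv_iff]
  have "(map snd \<Delta> @ [T]) ! i =
      subst (renaming (map fst (take i \<Delta>)) (map fst (take i \<Gamma>))) ((map snd \<Gamma> @ [S]) ! i)"
    if i: "i \<le> length \<Delta>" for i
  proof -
    have "subst (renaming (map fst (take i \<Delta>)) (map fst (take i \<Gamma>))) ((map snd \<Gamma> @ [S]) ! i) =
        subst (renaming (map fst (take i \<Delta>)) (map fst (take i \<Gamma>)))
         (subst (renaming (map fst (take i \<Gamma>)) (map fst (take i \<Delta>))) ((map snd \<Delta> @ [T]) ! i))"
      using jk i by metis
    also have "\<dots> = subst (renaming (map fst (take i \<Delta>)) (map fst (take i \<Delta>)))
        ((map snd \<Delta> @ [T]) ! i)"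
      by (rule subst_renaming_trans)
        (use jk i distinct_names[of \<Gamma> "IsType S" i]
          distinct_names[of \<Delta> "IsType T" i]
          vars_entry[of \<Delta> T i] in simp_all)
    finally show ?thesis by (simp add: renaming_self subst_Var)
  qed
  then show "(K, J) \<in> ty_equiv \<T>" unfolding J K ty_equiv_iff using jk by auto
qed

lemma ty_equiv_class_eq: "(J, K) \<in> ty_equiv \<T> \<Longrightarrow> ty_equiv \<T> `` {J} = ty_equiv \<T> `` {K}"
  using ty_equiv_trans ty_equiv_sym by (auto dest: transD symD)

lemma ty_equiv_boundary:
  assumes JK: "(J, K) \<in> ty_equiv \<T>" and "fst J \<noteq> []"
  shows "(hd (boundary J), hd (boundary K)) \<in> ty_equiv \<T>"
proof -
  obtain \<Gamma>' S \<Delta>' T where J: "J = (\<Gamma>', IsType S)" and K: "K = (\<Delta>', IsType T)"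
    by (rule ty_equivE[OF JK])
  note jk = JK[unfolded J K ty_equiv_iff]
  obtain \<Gamma> x A where \<Gamma>: "\<Gamma>' = \<Gamma> @ [(x, A)]" using assms J by (cases \<Gamma>' rule: rev_cases) auto
  obtain \<Delta> y B where \<Delta>: "\<Delta>' = \<Delta> @ [(y, B)]" using jk \<Gamma> by (cases \<Delta>' rule: rev_cases) auto
  have len: "length \<Gamma> = length \<Delta>" using jk \<Gamma> \<Delta> by simp
  have "(map snd \<Gamma> @ [A]) ! i = subst (renaming (map fst (take i \<Gamma>)) (map fst (take i \<Delta>)))
      ((map snd \<Delta> @ [B]) ! i)" if "i \<le> length \<Gamma>" for i
  proof -
    have "(map snd \<Gamma>' @ [S]) ! i = subst (renaming (map fst (take i \<Gamma>')) (map fst (take i \<Delta>')))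
      ((map snd \<Delta>' @ [T]) ! i)" using jk \<Gamma> that by simp
    then show ?thesis using \<Gamma> \<Delta> that len by (simp add: nth_append split: if_splits)
  qed
  moreover have "(\<Gamma>, IsType A) \<in> \<D>" "(\<Delta>, IsType B) \<in> \<D>"
    using derived_ctx_and_term jk \<Gamma> \<Delta> ctx_derivedD by fastforce+
  ultimately show ?thesis using len by (simp add: J K \<Gamma> \<Delta> ty_equiv_iff)
qed

text \<open>The boundary of a class is computed with \<open>the_elem\<close>, so it equals the class of the boundary of
  a chosen representative only once all representatives are known to give the same class.\<close>

lemma bdTy_V_class:
  assumes "(\<Gamma> @ [(x, A)], IsType S) \<in> \<D>"
  shows "bdTy (V \<T>) n (ty_equiv \<T> `` {(\<Gamma> @ [(x, A)], IsType S)}) = ty_equiv \<T> `` {(\<Gamma>, IsType A)}"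
proof -
  let ?J = "(\<Gamma> @ [(x, A)], IsType S)"
  have "ty_equiv \<T> `` {hd (boundary K)} = ty_equiv \<T> `` {(\<Gamma>, IsType A)}"
    if "K \<in> ty_equiv \<T> `` {?J}" for K
    using ty_equiv_class_eq[OF ty_equiv_boundary[of ?J K]] that by simp
  moreover have "?J \<in> ty_equiv \<T> `` {?J}" using ty_equiv_refl[OF assms] by simp
  ultimately have "(\<lambda>J. ty_equiv \<T> `` {hd (boundary J)}) ` (ty_equiv \<T> `` {?J})
      = {ty_equiv \<T> `` {(\<Gamma>, IsType A)}}" by blast
  then show ?thesis by (simp add: V_def)
qed

lemma tm_equiv_refl:
  assumes "(\<Gamma>, OfType s S) \<in> \<D>" "(\<Gamma>, IsType S) \<in> \<D>"
  shows "((\<Gamma>, OfType s S), (\<Gamma>, OfType s S)) \<in> tm_equiv \<T>"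
  using assms ty_equiv_refl[OF assms(2)]
  by (auto simp: tm_equiv_def renaming_self subst_Var intro: derived.tm_refl)

lemma bdTm_V_class:
  assumes "(\<Gamma>, OfType s S) \<in> \<D>" "(\<Gamma>, IsType S) \<in> \<D>"
  shows "bdTm (V \<T>) n (tm_equiv \<T> `` {(\<Gamma>, OfType s S)}) = ty_equiv \<T> `` {(\<Gamma>, IsType S)}"
proof -
  let ?J = "(\<Gamma>, OfType s S)"
  have "ty_equiv \<T> `` {hd (boundary K)} = ty_equiv \<T> `` {(\<Gamma>, IsType S)}"
    if "K \<in> tm_equiv \<T> `` {?J}" for K
  proof -
    obtain \<Delta> t T where "K = (\<Delta>, OfType t T)" "((\<Gamma>, IsType S), (\<Delta>, IsType T)) \<in> ty_equiv \<T>"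
      using \<open>K \<in> tm_equiv \<T> `` {?J}\<close> by (auto simp: tm_equiv_def)
    then show ?thesis by (simp add: ty_equiv_class_eq)
  qed
  moreover have "?J \<in> tm_equiv \<T> `` {?J}" using tm_equiv_refl[OF assms] by simp
  ultimately have "(\<lambda>J. ty_equiv \<T> `` {hd (boundary J)}) ` (tm_equiv \<T> `` {?J})
      = {ty_equiv \<T> `` {(\<Gamma>, IsType S)}}" by blast
  then show ?thesis by (simp add: V_def)
qed

end

section \<open>The unit as a map of presheaves\<close>

lemma equation_free_gat_free_gat:
  assumes "presheaf X" shows "equation_free_gat (free_gat X)"
proof
  show "gat (free_gat X)" using assms by (rule gat_free_gat)
qed (auto simp: free_basic ty_axiom_def tm_axiom_def)

lemma presheaf_degree:
  assumes "presheaf X"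
  shows "A \<in> Ty X n \<Longrightarrow> 1 \<le> n" "a \<in> Tm X n \<Longrightarrow> 1 \<le> n"
  using assms by (cases n; auto simp: presheaf_def)+

lemma presheaf_bd:
  assumes "presheaf X"
  shows "1 \<le> n \<Longrightarrow> A \<in> Ty X (Suc n) \<Longrightarrow> bdTy X n A \<in> Ty X n"
    and "a \<in> Tm X n \<Longrightarrow> bdTm X n a \<in> Ty X n"
  using assms presheaf_degree(2)[OF assms, of a n] by (auto simp: presheaf_def Pi_def)

lemma free_unit_hom:
  assumes p: "presheaf X"
  shows "free_unit X \<in> hom X (V (free_gat X))"
proof -
  interpret equation_free_gat "free_gat X" using p by (rule equation_free_gat_free_gat)
  let ?D = "derived (Basic (free_gat X))"
  have ty: "ty_axiom X n A \<in> ty_jdgs (free_gat X) n" if "A \<in> Ty X n" for n A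
    using ty_axiom_derived[OF p that] presheaf_degree(1)[OF p that]
    by (auto simp: ty_jdgs_def degree_def ty_axiom_def free_ctx_def)
  have tm: "tm_axiom X n a \<in> tm_jdgs (free_gat X) n" if "a \<in> Tm X n" for n a
    using tm_axiom_derived[OF p that] presheaf_degree(2)[OF p that]
    by (auto simp: tm_jdgs_def degree_def tm_axiom_def free_ctx_def)
  have bty: "fst (free_unit X) n (bdTy X n A) = bdTy (V (free_gat X)) n (fst (free_unit X) (Suc n) A)"
    if "1 \<le> n" "A \<in> Ty X (Suc n)" for n A
    using bdTy_V_class[of "free_ctx X n (bdTy X n A)" n "free_ty n (bdTy X n A)" "free_ty (Suc n) A" n]
      ty_axiom_derived[OF p that(2)] presheaf_bd(1)[OF p that] that
    by (simp add: free_unit_def ty_axiom_def free_ctx_Suc)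
  have btm: "fst (free_unit X) n (bdTm X n a) = bdTm (V (free_gat X)) n (snd (free_unit X) n a)"
    if "a \<in> Tm X n" for n a
    using tm_axiom_derived[OF p that] ty_axiom_derived[OF p presheaf_bd(2)[OF p that]]
      presheaf_bd(2)[OF p that] that
    by (simp add: free_unit_def ty_axiom_def tm_axiom_def bdTm_V_class)
  have "fst (free_unit X) n \<in> Ty X n \<rightarrow>\<^sub>E Ty (V (free_gat X)) n"
    "snd (free_unit X) n \<in> Tm X n \<rightarrow>\<^sub>E Tm (V (free_gat X)) n" for n
    using ty tm by (auto simp: free_unit_def V_def intro!: quotientI)
  then show ?thesis using bty btm by (auto simp: hom_def case_prod_beta)
qed

section \<open>The unit in terms of inc-lists\<close>

lemma iota_inc: "iota n \<in> inc n"
  by (auto simp: inc_def iota_def strict_mono_on_def)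

lemma iota_nth: "i \<le> n \<Longrightarrow> iota n i = i"
  by (simp add: iota_def)

lemma iota_image: "iota n ` {0..n} = {0..n}"
  by (force simp: iota_def)

lemma cell_iota:
  "Ty (cell n (iota n)) i = (if 1 \<le> i \<and> i \<le> n then {i} else {})"
  "Tm (cell n (iota n)) i = {}"
  by (auto simp: cell_def iota_nth iota_image)

lemma bd_iter_in: "presheaf X \<Longrightarrow> 1 \<le> i \<Longrightarrow> A \<in> Ty X (i + k) \<Longrightarrow> bd_iter X i k A \<in> Ty X i"
  by (induction k arbitrary: A) (auto simp: presheaf_def Pi_def)

lemma bdTy_bd_iter: "bdTy X i (bd_iter X (Suc i) k A) = bd_iter X i (Suc k) A"
  by (induction k arbitrary: A) auto

lemma tilde_apply: "1 \<le> i \<Longrightarrow> i \<le> n \<Longrightarrow> fst (tilde X n A) i i = bd_iter X i (n - i) A"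
  by (simp add: tilde_def cell_iota)

lemma tilde_hom:
  assumes p: "presheaf X" and A: "A \<in> Ty X n"
  shows "tilde X n A \<in> hom (cell n (iota n)) X"
proof -
  have "bd_iter X i (n - i) A \<in> Ty X i" if "1 \<le> i" "i \<le> n" for i
    using bd_iter_in[OF p that(1), of A "n - i"] A that by simp
  moreover have "bd_iter X i (n - i) A = bdTy X i (bd_iter X (Suc i) (n - Suc i) A)"
    if "Suc i \<le> n" for i
    using that by (simp add: bdTy_bd_iter Suc_diff_Suc del: bd_iter.simps)
  ultimately show ?thesis
    by (auto simp: hom_def tilde_def cell_iota cell_def iota_nth split: if_splits)
qed

lemma restrict_iota: "restrict (iota (Suc n)) {0..n} = iota n"
  by (auto simp: iota_def)

lemma tts_restrict_tilde:
  "tts_restrict (cell n (iota n)) (tilde X (Suc n) A) = tilde X n (bdTy X n A)"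
proof -
  have "restrict (fst (tilde X (Suc n) A) i) (Ty (cell n (iota n)) i)
      = fst (tilde X n (bdTy X n A)) i" for i
    by (auto simp: tilde_def cell_iota Suc_diff_le fun_eq_iff)
  moreover have "restrict (snd (tilde X (Suc n) A) i) (Tm (cell n (iota n)) i)
      = snd (tilde X n (bdTy X n A)) i" for i
    by (auto simp: tilde_def cell_iota fun_eq_iff)
  ultimately show ?thesis by (simp add: tts_restrict_def prod_eq_iff)
qed

lemma inc_exp_iota: "j \<le> n \<Longrightarrow> inc_exp n (iota n) h j = Var j"
proof -
  assume j: "j \<le> n"
  then have "(THE m. m \<le> n \<and> iota n m = j) = j"
    by (intro the_equality) (auto simp: iota_nth)
  then show ?thesis using j by (simp add: inc_exp.simps[of _ _ _ j] iota_image)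
qed

lemma map_inc_exp_iota: "i \<le> n \<Longrightarrow> map (inc_exp n (iota n) h) [1..<i] = map Var [1..<i]"
  by (simp add: inc_exp_iota)

lemma inc_ty_tilde:
  "1 \<le> i \<Longrightarrow> i \<le> n \<Longrightarrow> inc_ty n (iota n) (tilde X n A) i = free_ty i (bd_iter X i (n - i) A)"
  by (simp add: inc_ty_def iota_nth tilde_apply free_ty_def inc_exp_iota)

lemma inc_ctx_tilde: "inc_ctx n (iota n) (tilde X n A) = free_ctx X n A"
  by (simp add: inc_ctx_def free_ctx_def inc_ty_tilde)

text \<open>The identification hits the class of an axiom only at the expected inc-list. The equivalence
  compares the types of the two judgements position by position after a renaming, and renamings
  do not change the outermost constant. That constant determines \<open>\<alpha>(i)\<close> and \<open>h(\<alpha>(i))\<close>; on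
  term-elements \<open>h\<close> then carries no data because \<open>[\<iota>\<^sub>n]\<close> has none.\<close>

lemma inc_list_of_axiom:
  assumes p: "presheaf X" and n: "1 \<le> n" and \<alpha>: "\<alpha> \<in> inc n" and h: "h \<in> hom (cell n \<alpha>) X"
    and eq: "((inc_ctx n \<alpha> h, IsType (inc_ty n \<alpha> h n)), ty_axiom X n A) \<in> ty_equiv (free_gat X)"
  shows "\<alpha> = iota n \<and> h = tilde X n A"
proof -
  interpret equation_free_gat "free_gat X" using p by (rule equation_free_gat_free_gat)
  \<comment> \<open>The \<open>i\<close>-th type has the list index \<open>i - 1\<close>.\<close>
  have heads: "\<alpha> i = i \<and> fst h i i = bd_iter X i (n - i) A" if i: "1 \<le> i" "i \<le> n" for i
  proof -
    let ?\<Gamma> = "inc_ctx n \<alpha> h" and ?\<Delta> = "free_ctx X n A"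
    have "(map snd ?\<Gamma> @ [inc_ty n \<alpha> h n]) ! (i - 1)
        = subst (renaming (map fst (take (i - 1) ?\<Gamma>)) (map fst (take (i - 1) ?\<Delta>)))
            ((map snd ?\<Delta> @ [free_ty n A]) ! (i - 1))"
    proof -
      have "i - 1 \<le> length ?\<Gamma>" using i by (simp add: inc_ctx_def)
      then show ?thesis using eq[unfolded ty_axiom_def ty_equiv_iff] by blast
    qed
    moreover have "(map snd ?\<Gamma> @ [inc_ty n \<alpha> h n]) ! (i - 1) = inc_ty n \<alpha> h i"
      using i by (cases "i = n") (auto simp: inc_ctx_def nth_append)
    moreover have "(map snd ?\<Delta> @ [free_ty n A]) ! (i - 1) = free_ty i (bd_iter X i (n - i) A)"
      using i by (cases "i = n") (auto simp: free_ctx_def nth_append)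
    ultimately show ?thesis by (auto simp: inc_ty_def free_ty_def)
  qed
  have iota: "\<alpha> = iota n"
  proof
    fix i
    show "\<alpha> i = iota n i"
      using heads[of i] \<alpha> by (cases "i = 0"; cases "i \<le> n") (auto simp: inc_def iota_def extensional_def)
  qed
  have ext: "fst h i \<in> extensional (Ty (cell n (iota n)) i)" "snd h i \<in> extensional {}" for i
    using h by (simp_all add: iota hom_def case_prod_beta PiE_iff cell_iota(2))
  have "fst h i j = fst (tilde X n A) i j" for i j
    using heads[of i] extensional_arb[OF ext(1)[of i], of j]
    by (auto simp: tilde_def cell_iota)
  moreover have "snd h i j = undefined" for i j
    using extensional_arb[OF ext(2)[of i], of j] by simp
  ultimately have "h = tilde X n A"
    by (auto simp: prod_eq_iff fun_eq_iff tilde_def)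
  then show ?thesis using iota by simp
qed

definition inc_unit ::
  "('a, 'b) tts \<Rightarrow> ('a, 'b, ('a, 'b) inc_elem, ('a, 'b) inc_elem \<times> 'b) tts_map" where
  "inc_unit X = (\<lambda>n. \<lambda>A\<in>Ty X n. (iota n, tilde X n A),
                 \<lambda>n. \<lambda>a\<in>Tm X n. ((iota n, tilde X n (bdTm X n a)), a))"

lemma tilde_inc_elem:
  "presheaf X \<Longrightarrow> A \<in> Ty X n \<Longrightarrow> (iota n, tilde X n A) \<in> inc_elems X n"
  using presheaf_degree(1)[of X A n] by (simp add: inc_elems_def iota_inc tilde_hom)

lemma tilde_inc_elem_tm:
  assumes p: "presheaf X" and a: "a \<in> Tm X n"
  shows "((iota n, tilde X n (bdTm X n a)), a) \<in> Tm (subst_monad X) n"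
  using presheaf_degree(2)[OF p a] tilde_inc_elem[OF p presheaf_bd(2)[OF p a]] a
  by (simp add: subst_monad_def Tm_over_def iota_nth tilde_apply)

lemma inc_unit_hom:
  assumes p: "presheaf X"
  shows "inc_unit X \<in> hom X (subst_monad X)"
proof -
  have "fst (inc_unit X) n \<in> Ty X n \<rightarrow>\<^sub>E Ty (subst_monad X) n"
    "snd (inc_unit X) n \<in> Tm X n \<rightarrow>\<^sub>E Tm (subst_monad X) n" for n
    using tilde_inc_elem[OF p] tilde_inc_elem_tm[OF p]
    by (auto simp: inc_unit_def subst_monad_def)
  moreover have "fst (inc_unit X) n (bdTy X n A) = bdTy (subst_monad X) n (fst (inc_unit X) (Suc n) A)"
    if "1 \<le> n" "A \<in> Ty X (Suc n)" for n A
    using that presheaf_bd(1)[OF p that]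
    by (simp add: inc_unit_def subst_monad_def restrict_iota tts_restrict_tilde)
  moreover have "fst (inc_unit X) n (bdTm X n a) = bdTm (subst_monad X) n (snd (inc_unit X) n a)"
    if "a \<in> Tm X n" for n a
    using that presheaf_bd(2)[OF p that] by (simp add: inc_unit_def subst_monad_def)
  ultimately show ?thesis by (auto simp: hom_def case_prod_beta)
qed

lemma ident_tilde:
  assumes p: "presheaf X"
  shows "A \<in> Ty X n \<Longrightarrow> fst (ident X) n (iota n, tilde X n A) = fst (free_unit X) n A"
    and "a \<in> Tm X n \<Longrightarrow>
      snd (ident X) n ((iota n, tilde X n (bdTm X n a)), a) = snd (free_unit X) n a"
proof -
  assume A: "A \<in> Ty X n"
  then show "fst (ident X) n (iota n, tilde X n A) = fst (free_unit X) n A"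
    using presheaf_degree(1)[OF p A] tilde_inc_elem[OF p A]
    by (simp add: ident_def free_unit_def ty_axiom_def inc_ctx_tilde inc_ty_tilde subst_monad_def)
next
  assume a: "a \<in> Tm X n"
  then show "snd (ident X) n ((iota n, tilde X n (bdTm X n a)), a) = snd (free_unit X) n a"
    using presheaf_degree(2)[OF p a] tilde_inc_elem_tm[OF p a]
    by (simp add: ident_def free_unit_def tm_axiom_def inc_ctx_tilde inc_ty_tilde iota_nth
        map_inc_exp_iota del: One_nat_def)
qed

lemma ident_inc_unit:
  assumes p: "presheaf X"
  shows "tts_comp X (ident X) (inc_unit X) = free_unit X"
proof -
  have "compose (Ty X n) (fst (ident X) n) (fst (inc_unit X) n) A = fst (free_unit X) n A" for n A
    using ident_tilde(1)[OF p, of A n] by (auto simp: compose_def inc_unit_def free_unit_def)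
  moreover have "compose (Tm X n) (snd (ident X) n) (snd (inc_unit X) n) a = snd (free_unit X) n a" for n a
    using ident_tilde(2)[OF p, of a n] by (auto simp: compose_def inc_unit_def free_unit_def)
  ultimately show ?thesis by (simp add: tts_comp_def prod_eq_iff fun_eq_iff)
qed

text \<open>Equality of classes gives back an equivalence of representatives because the class of a
  derived axiom contains that axiom, and in particular is not empty.\<close>

lemma ident_eq_unitD:
  assumes p: "presheaf X"
  shows "A \<in> Ty X n \<Longrightarrow> x \<in> Ty (subst_monad X) n \<Longrightarrow> fst (ident X) n x = fst (free_unit X) n A
      \<Longrightarrow> x = (iota n, tilde X n A)"
    and "a \<in> Tm X n \<Longrightarrow> y \<in> Tm (subst_monad X) n \<Longrightarrow> snd (ident X) n y = snd (free_unit X) n a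
      \<Longrightarrow> y = ((iota n, tilde X n (bdTm X n a)), a)"
proof -
  interpret equation_free_gat "free_gat X" using p by (rule equation_free_gat_free_gat)
  assume A: "A \<in> Ty X n" and x: "x \<in> Ty (subst_monad X) n"
    and eq: "fst (ident X) n x = fst (free_unit X) n A"
  obtain \<alpha> h where xh: "x = (\<alpha>, h)" by (cases x)
  have "(ty_axiom X n A, ty_axiom X n A) \<in> ty_equiv (free_gat X)"
    using ty_axiom_derived[OF p A] ty_equiv_refl by (simp add: ty_axiom_def)
  then have "((inc_ctx n \<alpha> h, IsType (inc_ty n \<alpha> h n)), ty_axiom X n A) \<in> ty_equiv (free_gat X)"
    using eq x A by (auto simp: xh ident_def free_unit_def)
  then show "x = (iota n, tilde X n A)"
    using inc_list_of_axiom[OF p presheaf_degree(1)[OF p A], of \<alpha> h A] x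
    by (simp add: xh subst_monad_def inc_elems_def split: if_splits)
next
  interpret equation_free_gat "free_gat X" using p by (rule equation_free_gat_free_gat)
  assume a: "a \<in> Tm X n" and y: "y \<in> Tm (subst_monad X) n"
    and eq: "snd (ident X) n y = snd (free_unit X) n a"
  obtain \<alpha> h b where yh: "y = ((\<alpha>, h), b)" by (metis prod.exhaust)
  have "(tm_axiom X n a, tm_axiom X n a) \<in> tm_equiv (free_gat X)"
    using tm_axiom_derived[OF p a] ty_axiom_derived[OF p presheaf_bd(2)[OF p a]] tm_equiv_refl
    by (simp add: tm_axiom_def ty_axiom_def)
  then have e: "((inc_ctx n \<alpha> h,
      OfType (Op (Inr (\<alpha> n, b)) (map (inc_exp n \<alpha> h) [1..<\<alpha> n])) (inc_ty n \<alpha> h n)), tm_axiom X n a)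
      \<in> tm_equiv (free_gat X)"
    using eq y a by (auto simp: yh ident_def free_unit_def)
  then have "((inc_ctx n \<alpha> h, IsType (inc_ty n \<alpha> h n)), ty_axiom X n (bdTm X n a))
      \<in> ty_equiv (free_gat X)"
    by (auto simp: tm_equiv_def tm_axiom_def ty_axiom_def)
  then have "\<alpha> = iota n \<and> h = tilde X n (bdTm X n a)"
    using inc_list_of_axiom[OF p presheaf_degree(2)[OF p a], of \<alpha> h "bdTm X n a"] y
    by (simp add: yh subst_monad_def inc_elems_def split: if_splits)
  moreover have "b = a"
    using e by (auto simp: tm_equiv_def tm_axiom_def dest!: derived_TermEqD)
  ultimately show "y = ((iota n, tilde X n (bdTm X n a)), a)" by (simp add: yh)
qed

lemma inc_unit_unique:
  assumes p: "presheaf X" and \<eta>: "\<eta> \<in> hom X (subst_monad X)"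
    and eq: "tts_comp X (ident X) \<eta> = free_unit X"
  shows "\<eta> = inc_unit X"
proof -
  have ty: "fst \<eta> n \<in> Ty X n \<rightarrow>\<^sub>E Ty (subst_monad X) n"
    and tm: "snd \<eta> n \<in> Tm X n \<rightarrow>\<^sub>E Tm (subst_monad X) n" for n
    using \<eta> by (simp_all add: hom_def case_prod_beta)
  have "fst \<eta> n A = fst (inc_unit X) n A" for n A
  proof (cases "A \<in> Ty X n")
    case True
    then have "fst (ident X) n (fst \<eta> n A) = fst (free_unit X) n A"
      using eq[symmetric] by (simp add: tts_comp_def compose_def)
    then show ?thesis
      using True ty[of n] by (auto simp: inc_unit_def dest: ident_eq_unitD(1)[OF p, rotated -1])
  next
    case False
    then show ?thesis using ty[of n] by (auto simp: inc_unit_def)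
  qed
  moreover have "snd \<eta> n a = snd (inc_unit X) n a" for n a
  proof (cases "a \<in> Tm X n")
    case True
    then have "snd (ident X) n (snd \<eta> n a) = snd (free_unit X) n a"
      using eq[symmetric] by (simp add: tts_comp_def compose_def)
    then show ?thesis
      using True tm[of n] by (auto simp: inc_unit_def dest: ident_eq_unitD(2)[OF p, rotated -1])
  next
    case False
    then show ?thesis using tm[of n] by (auto simp: inc_unit_def)
  qed
  ultimately show ?thesis by (simp add: prod_eq_iff fun_eq_iff)
qed

theorem proposition32:
  fixes X :: "('a, 'b) tts"
  assumes "presheaf X"
  shows "free_unit X \<in> hom X (V (free_gat X)) \<and>
    (\<exists>\<eta> \<in> hom X (subst_monad X).
       tts_comp X (ident X) \<eta> = free_unit X \<and>
       (\<forall>\<eta>' \<in> hom X (subst_monad X). tts_comp X (ident X) \<eta>' = free_unit X \<longrightarrow> \<eta>' = \<eta>) \<and>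
       (\<forall>n. \<forall>A \<in> Ty X n.
          fst \<eta> n A = (iota n, tilde X n A) \<and>
          (\<forall>a \<in> Tm_over X n A.
             snd \<eta> n a \<in> Tm_over (subst_monad X) n (iota n, tilde X n A) \<and>
             snd \<eta> n a = ((iota n, tilde X n A), a))))"
proof (intro conjI bexI[of _ "inc_unit X"] ballI allI impI)
  fix n A a assume "A \<in> Ty X n" and a: "a \<in> Tm_over X n A"
  then show "snd (inc_unit X) n a = ((iota n, tilde X n A), a)"
    by (auto simp: inc_unit_def Tm_over_def)
  then show "snd (inc_unit X) n a \<in> Tm_over (subst_monad X) n (iota n, tilde X n A)"
    using tilde_inc_elem_tm[OF assms, of a n] a by (auto simp: Tm_over_def subst_monad_def)
next
  fix n A assume "A \<in> Ty X n"
  then show "fst (inc_unit X) n A = (iota n, tilde X n A)" by (simp add: inc_unit_def)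
next
  fix \<eta>' assume "\<eta>' \<in> hom X (subst_monad X)" "tts_comp X (ident X) \<eta>' = free_unit X"
  then show "\<eta>' = inc_unit X" by (rule inc_unit_unique[OF assms])
qed (fact free_unit_hom[OF assms] inc_unit_hom[OF assms] ident_inc_unit[OF assms])+

end
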